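(* Let $A$, the iterates $u_k$, the corrections $s_k$ and the errors $e_k$ be as in the context. There exists a positive number $\delta$ such that if $\|e_k\|<\delta$ then $$\|s_k\|\le 3\|e_k\|.$$
   Context: $A\in\mathbb{R}^{n\times n}$ is symmetric positive definite with eigenvalues $\lambda_1<\lambda_2<\dots<\lambda_n$ and unit eigenvector $v_1$ for $\lambda_1$. Norms are Euclidean. Newton iteration: $u_0$ is a unit vector; for $k\ge 0$, $\theta_k=u_k^\top A u_k$, and $s_k$ is an (exact or approximate) solution, lying in the subspace orthogonal to $u_k$, of the correction equation $$(I-u_ku_k^\top)(A-\theta_k I)(I-u_ku_k^\top)s_k=-(Au_k-\theta_ku_k).$$ Then $$u_{k+1}=\frac{u_k+s_k}{\|u_k+s_k\|}=\frac{u_k+s_k}{\sqrt{1+\|s_k\|^2}}.$$ Set $e_k=u_k-v_1$. Standing assumption: convergence holds, i.e. there is a constant $r<1$ with $\|e_{k+1}\|<r\|e_k\|$ for all $k\ge0$. The number $\delta$ does not depend on $k$. *)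

theory Defs
  imports "HOL-Analysis.Analysis"
begin

definition symmetric_positive_definite :: "real ^ 'n ^ 'n \<Rightarrow> bool" where
  "symmetric_positive_definite A \<longleftrightarrow>
     transpose A = A \<and> (\<forall>x. x \<noteq> 0 \<longrightarrow> x \<bullet> (A *v x) > 0)"

definition eigenvalues :: "real ^ 'n ^ 'n \<Rightarrow> real set" where
  "eigenvalues A = {\<mu>. \<exists>v. v \<noteq> 0 \<and> A *v v = \<mu> *\<^sub>R v}"

text \<open>The matrix \<open>I - u u\<^sup>T\<close>; the intermediate index type \<open>1\<close> makes the two factors
  an \<open>n\<close> by \<open>1\<close> and a \<open>1\<close> by \<open>n\<close> matrix.\<close>

definition projector :: "real ^ 'n \<Rightarrow> real ^ 'n ^ 'n" where
  "projector u = mat 1 - (columnvector u :: real ^ 1 ^ 'n) ** (rowvector u :: real ^ 'n ^ 1)"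

definition rayleigh :: "real ^ 'n ^ 'n \<Rightarrow> real ^ 'n \<Rightarrow> real" where
  "rayleigh A u = u \<bullet> (A *v u)"

text \<open>The vector \<open>s\<close> is orthogonal to \<open>u\<close> and solves the correction equation
  \<open>(I - u u\<^sup>T) (A - \<theta> I) (I - u u\<^sup>T) s = - (A u - \<theta> u)\<close> up to a residual of norm
  at most \<open>\<tau>\<close>.  Exact solutions are those with \<open>\<tau> = 0\<close>.\<close>

definition solves_correction ::
    "real ^ 'n ^ 'n \<Rightarrow> real \<Rightarrow> real ^ 'n \<Rightarrow> real ^ 'n \<Rightarrow> bool" where
  "solves_correction A \<tau> u s \<longleftrightarrow>
     orthogonal u s \<and>
     norm ((projector u ** (A - rayleigh A u *\<^sub>R mat 1) ** projector u) *v s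
           - (- (A *v u - rayleigh A u *\<^sub>R u))) \<le> \<tau>"

text \<open>The tolerances \<open>\<tau> k\<close> may vary from step to step.  For a unit vector \<open>u k\<close>
  orthogonal to \<open>s k\<close>, the normalising factor equals \<open>sqrt (1 + (norm (s k))\<^sup>2)\<close>.\<close>

definition newton_iteration ::
    "real ^ 'n ^ 'n \<Rightarrow> (nat \<Rightarrow> real) \<Rightarrow> (nat \<Rightarrow> real ^ 'n) \<Rightarrow> (nat \<Rightarrow> real ^ 'n) \<Rightarrow> bool" where
  "newton_iteration A \<tau> u s \<longleftrightarrow>
     norm (u 0) = 1 \<and>
     (\<forall>k. solves_correction A (\<tau> k) (u k) (s k) \<and>
          u (Suc k) = (u k + s k) /\<^sub>R norm (u k + s k))"

end

theory Submission
  imports Defs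
begin

(* The estimate is purely geometric. Since s is orthogonal to the unit vector u, norm s is the
   tangent of the angle between u and the next iterate, whereas the distance of the two iterates is
   the chord of that angle. By linear convergence the chord is at most 2 * norm e, and for small
   angles the tangent is at most 3/2 times the chord. *)

lemma norm_add_orthogonal_unit:
  assumes "norm a = 1" "orthogonal a b"
  shows "(norm (a + b))\<^sup>2 = 1 + (norm b)\<^sup>2"
  using norm_add_Pythagorean[OF assms(2)] assms(1) by simp

lemma add_orthogonal_unit_nonzero:
  assumes "norm a = 1" "orthogonal a b"
  shows "a + b \<noteq> 0"
proof
  assume "a + b = 0"
  with norm_add_orthogonal_unit[OF assms] have "1 + (norm b)\<^sup>2 = 0"
    by simp
  then show False
    using zero_le_power2[of "norm b"] by linarith
qed

lemma tangent_le_chord: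
  fixes a b :: "'a :: real_inner"
  assumes unit: "norm a = 1" and orth: "orthogonal a b"
    and chord: "norm ((a + b) /\<^sub>R norm (a + b) - a) \<le> 2 * \<epsilon>"
    and small: "\<epsilon> < 1 / 3"
  shows "norm b \<le> 3 * \<epsilon>"
proof -
  define N where "N = norm (a + b)"
  define w where "w = (a + b) /\<^sub>R N"
  define x where "x = \<epsilon>\<^sup>2"
  have N2: "N\<^sup>2 = 1 + (norm b)\<^sup>2"
    using norm_add_orthogonal_unit[OF unit orth] by (simp add: N_def)
  have N: "N > 0"
    using add_orthogonal_unit_nonzero[OF unit orth] by (simp add: N_def)
  have \<epsilon>: "\<epsilon> \<ge> 0"
    using chord norm_ge_zero[of "(a + b) /\<^sub>R norm (a + b) - a"] by linarith
  have x: "0 \<le> x" "x \<le> 1 / 9"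
    using power_mono[of \<epsilon> "1 / 3" 2] \<epsilon> small by (auto simp: x_def power2_eq_square)
  have aa: "a \<bullet> a = 1"
    using unit by (simp add: norm_eq_1)
  have "norm w = 1"
    using N by (simp add: w_def N_def)
  then have "w \<bullet> w = 1"
    by (simp add: norm_eq_1)
  moreover have "a \<bullet> w = 1 / N"
    using orth aa by (simp add: w_def inner_add_right orthogonal_def divide_inverse)
  ultimately have "(norm (w - a))\<^sup>2 = 2 - 2 / N"
    using aa by (simp add: power2_norm_eq_inner inner_diff_left inner_diff_right inner_commute)
  moreover have "(norm (w - a))\<^sup>2 \<le> 4 * x"
    using power_mono[OF chord, of 2] by (simp add: w_def N_def x_def power_mult_distrib)
  ultimately have "1 - 2 * x \<le> 1 / N"
    by simp
  then have "N * (1 - 2 * x) \<le> 1"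
    using N by (simp add: field_simps)
  then have "(N * (1 - 2 * x))\<^sup>2 \<le> 1"
    using N x by (simp add: power_le_one)
  then have "(1 + (norm b)\<^sup>2) * (1 - 2 * x)\<^sup>2 \<le> 1"
    by (simp add: power_mult_distrib N2)
  also have "1 \<le> (1 + 9 * x) * (1 - 2 * x)\<^sup>2"
  proof -
    have "0 \<le> x * (5 - 32 * x + 36 * x\<^sup>2)"
      using x by simp
    then show ?thesis
      by (simp add: power2_eq_square algebra_simps)
  qed
  finally have "(norm b)\<^sup>2 \<le> 9 * x"
    using x by simp
  then have "(norm b)\<^sup>2 \<le> (3 * \<epsilon>)\<^sup>2"
    by (simp add: x_def power_mult_distrib)
  then show ?thesis
    by (rule power2_le_imp_le) (use \<epsilon> in simp)
qed

lemma newton_iteration_orthogonal: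
  assumes "newton_iteration A \<tau> u s"
  shows "orthogonal (u k) (s k)"
  using assms by (simp add: newton_iteration_def solves_correction_def)

lemma newton_iteration_norm:
  assumes "newton_iteration A \<tau> u s"
  shows "norm (u k) = 1"
proof (induction k)
  case 0
  then show ?case
    using assms by (simp add: newton_iteration_def)
next
  case (Suc k)
  then have "u k + s k \<noteq> 0"
    using newton_iteration_orthogonal[OF assms] by (rule add_orthogonal_unit_nonzero)
  then show ?case
    using assms by (simp add: newton_iteration_def)
qed

theorem lemma3p4:
  fixes A :: "real ^ 'n ^ 'n"
    and lam :: "nat \<Rightarrow> real"
    and v1 :: "real ^ 'n"
    and \<tau> :: "nat \<Rightarrow> real"
    and u s e :: "nat \<Rightarrow> real ^ 'n"
    and r :: real
  assumes "symmetric_positive_definite A"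
    and "strict_mono_on {1..CARD('n)} lam"
    and "eigenvalues A = lam ` {1..CARD('n)}"
    and "norm v1 = 1" and "A *v v1 = lam 1 *\<^sub>R v1"
    and "newton_iteration A \<tau> u s"
    and "\<And>k. e k = u k - v1"
    and "r < 1" and "\<And>k. norm (e (Suc k)) < r * norm (e k)"
  shows "\<exists>\<delta>>0. \<forall>k. norm (e k) < \<delta> \<longrightarrow> norm (s k) \<le> 3 * norm (e k)"
proof (intro exI[of _ "1 / 3"] conjI allI impI)
  fix k assume small: "norm (e k) < 1 / 3"
  have "norm (e (Suc k)) \<le> norm (e k)"
    using assms(9)[of k] mult_right_mono[of r 1 "norm (e k)"] assms(8) by simp
  moreover have "u (Suc k) - u k = e (Suc k) - e k"
    by (simp add: assms(7))
  ultimately have "norm (u (Suc k) - u k) \<le> 2 * norm (e k)"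
    using norm_triangle_ineq4[of "e (Suc k)" "e k"] by simp
  moreover have "u (Suc k) = (u k + s k) /\<^sub>R norm (u k + s k)"
    using assms(6) by (simp add: newton_iteration_def)
  ultimately show "norm (s k) \<le> 3 * norm (e k)"
    using tangent_le_chord newton_iteration_norm[OF assms(6)]
      newton_iteration_orthogonal[OF assms(6)] small by metis
qed simp

end
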